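(* Let $m, b$ be natural numbers with $m \ge 29$ and $b \ge 2m - s$ for some $s$ with $0 \le s \le \frac{m-22}{14}$. Then Breaker has a winning strategy for the $(m,b)$ Maker-Breaker percolation game on $\mathbb{Z}^2$, which moreover ensures that he wins within the first $3$ rounds of the game.
   Context: $\mathbb{Z}^2$ denotes the square lattice: the infinite graph whose vertices are the points $(x,y)$ with $x,y\in\mathbb{Z}$, two points being joined by an edge iff $|x-x'|+|y-y'|=1$. Fix an origin vertex $v_0$ (by transitivity the choice is irrelevant). The $(m,b)$ Maker-Breaker percolation game on $\mathbb{Z}^2$ is played on the edge set of $\mathbb{Z}^2$. In each round $1,2,3,\dots$, first Maker claims $m$ as yet unclaimed edges, then Breaker claims $b$ as yet unclaimed edges. Breaker wins if at some finite point of the game he has claimed at least one edge of every infinite connected subgraph of $\mathbb{Z}^2$ containing $v_0$; equivalently, if the connected component of $v_0$ in the graph formed by Maker's edges and the unclaimed edges becomes finite. Otherwise Maker wins. Breaker wins within the first $k$ rounds if this has happened by the end of round $k$. *)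

theory Defs
  imports Complex_Main
begin

type_synonym vertex = "int \<times> int"
type_synonym edge = "vertex set"

definition lattice_adj :: "vertex \<Rightarrow> vertex \<Rightarrow> bool" where
  "lattice_adj u v \<longleftrightarrow> \<bar>fst u - fst v\<bar> + \<bar>snd u - snd v\<bar> = 1"

definition lattice_edges :: "edge set" where
  "lattice_edges = {{u, v} | u v. lattice_adj u v}"

text \<open>A subgraph is given by its vertex set \<open>W\<close> and its edge set \<open>F\<close>.\<close>

definition lattice_subgraph :: "vertex set \<Rightarrow> edge set \<Rightarrow> bool" where
  "lattice_subgraph W F \<longleftrightarrow> F \<subseteq> lattice_edges \<and> (\<forall>e\<in>F. e \<subseteq> W)"

definition joined :: "edge set \<Rightarrow> (vertex \<times> vertex) set" where
  "joined F = {(u, v). {u, v} \<in> F}\<^sup>*"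

definition connected_graph :: "vertex set \<Rightarrow> edge set \<Rightarrow> bool" where
  "connected_graph W F \<longleftrightarrow> W \<noteq> {} \<and> (\<forall>u\<in>W. \<forall>v\<in>W. (u, v) \<in> joined F)"

definition encloses :: "vertex \<Rightarrow> edge set \<Rightarrow> bool" where
  "encloses v0 B \<longleftrightarrow>
     (\<forall>W F. lattice_subgraph W F \<and> connected_graph W F \<and> infinite W \<and> v0 \<in> W
        \<longrightarrow> F \<inter> B \<noteq> {})"

text \<open>Maker's edges together with the unclaimed edges are exactly the edges outside Breaker's
  set \<open>B\<close>, so the next lemma is the description of Breaker's goal by the component of \<open>v0\<close>.\<close>

lemma encloses_iff_finite_component:
  "encloses v0 B \<longleftrightarrow> finite {v. (v0, v) \<in> joined (lattice_edges - B)}"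
proof
  let ?C = "{v. (v0, v) \<in> joined (lattice_edges - B)}"
  let ?F = "{e \<in> lattice_edges - B. e \<subseteq> ?C}"
  assume enc: "encloses v0 B"
  have reach: "(v0, v) \<in> joined ?F" if "(v0, v) \<in> joined (lattice_edges - B)" for v
    using that unfolding joined_def
  proof (induction rule: rtrancl_induct)
    case (step y z)
    then have "{y, z} \<in> ?F"
      by (auto simp: joined_def intro: rtrancl_into_rtrancl)
    with step.IH show ?case
      by (auto simp: joined_def intro: rtrancl_into_rtrancl)
  qed simp
  have "sym (joined ?F)"
    unfolding joined_def by (intro sym_rtrancl) (auto simp: sym_def insert_commute)
  have "v0 \<in> ?C"
    by (simp add: joined_def)
  have "(u, v) \<in> joined ?F" if "u \<in> ?C" "v \<in> ?C" for u v
  proof -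
    have "(u, v0) \<in> joined ?F" "(v0, v) \<in> joined ?F"
      using reach that \<open>sym (joined ?F)\<close> by (blast dest: symD)+
    then show ?thesis
      unfolding joined_def by (rule rtrancl_trans)
  qed
  with \<open>v0 \<in> ?C\<close> have "connected_graph ?C ?F"
    unfolding connected_graph_def by blast
  moreover have "lattice_subgraph ?C ?F" "?F \<inter> B = {}"
    unfolding lattice_subgraph_def by blast+
  moreover note \<open>v0 \<in> ?C\<close>
  ultimately show "finite ?C"
    using enc unfolding encloses_def by blast
next
  assume fin: "finite {v. (v0, v) \<in> joined (lattice_edges - B)}"
  show "encloses v0 B"
    unfolding encloses_def
  proof (intro allI impI notI, elim conjE)
    fix W F
    assume "lattice_subgraph W F" "connected_graph W F" "infinite W" "v0 \<in> W" "F \<inter> B = {}"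
    then have "F \<subseteq> lattice_edges - B" "\<forall>v\<in>W. (v0, v) \<in> joined F"
      by (auto simp: lattice_subgraph_def connected_graph_def)
    moreover from this(1) have "joined F \<subseteq> joined (lattice_edges - B)"
      unfolding joined_def by (intro rtrancl_mono) auto
    ultimately have "W \<subseteq> {v. (v0, v) \<in> joined (lattice_edges - B)}"
      by auto
    with fin \<open>infinite W\<close> show False
      using finite_subset by blast
  qed
qed

text \<open>A history lists the completed rounds, earliest first, as pairs of the set of edges claimed
  by Maker and the set of edges claimed by Breaker in that round.\<close>

type_synonym history = "(edge set \<times> edge set) list"

definition maker_edges :: "history \<Rightarrow> edge set" where
  "maker_edges h = \<Union>(set (map fst h))"

definition breaker_edges :: "history \<Rightarrow> edge set" where
  "breaker_edges h = \<Union>(set (map snd h))"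

definition claimed :: "history \<Rightarrow> edge set" where
  "claimed h = maker_edges h \<union> breaker_edges h"

definition legal_claim :: "nat \<Rightarrow> edge set \<Rightarrow> edge set \<Rightarrow> bool" where
  "legal_claim k C S \<longleftrightarrow> S \<subseteq> lattice_edges - C \<and> finite S \<and> card S = k"

inductive legal_history :: "nat \<Rightarrow> nat \<Rightarrow> history \<Rightarrow> bool" for m b where
  start: "legal_history m b []"
| round: "legal_history m b h \<Longrightarrow> legal_claim m (claimed h) M \<Longrightarrow>
    legal_claim b (claimed h \<union> M) B \<Longrightarrow> legal_history m b (h @ [(M, B)])"

text \<open>A strategy of Breaker answers the completed rounds and Maker's claim in the current round.
  It has to answer legally in every legal situation, so that play never gets stuck.\<close>

type_synonym strategy = "history \<Rightarrow> edge set \<Rightarrow> edge set"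

definition breaker_strategy :: "nat \<Rightarrow> nat \<Rightarrow> strategy \<Rightarrow> bool" where
  "breaker_strategy m b \<sigma> \<longleftrightarrow>
     (\<forall>h M. legal_history m b h \<and> legal_claim m (claimed h) M
        \<longrightarrow> legal_claim b (claimed h \<union> M) (\<sigma> h M))"

text \<open>Plays go on forever, also after Breaker has reached his goal; this is harmless since the
  goal is preserved when Breaker claims more edges. Round \<open>i + 1\<close> of a play \<open>p\<close> is \<open>p i\<close>.\<close>

definition rounds :: "(nat \<Rightarrow> edge set \<times> edge set) \<Rightarrow> nat \<Rightarrow> history" where
  "rounds p n = map p [0..<n]"

definition play_against :: "nat \<Rightarrow> nat \<Rightarrow> strategy \<Rightarrow> (nat \<Rightarrow> edge set \<times> edge set) \<Rightarrow> bool" where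
  "play_against m b \<sigma> p \<longleftrightarrow>
     (\<forall>n. legal_history m b (rounds p n)) \<and>
     (\<forall>n. snd (p n) = \<sigma> (rounds p n) (fst (p n)))"

definition breaker_wins_within :: "vertex \<Rightarrow> nat \<Rightarrow> (nat \<Rightarrow> edge set \<times> edge set) \<Rightarrow> bool" where
  "breaker_wins_within v0 k p \<longleftrightarrow> (\<exists>n\<le>k. encloses v0 (breaker_edges (rounds p n)))"

definition breaker_wins :: "vertex \<Rightarrow> (nat \<Rightarrow> edge set \<times> edge set) \<Rightarrow> bool" where
  "breaker_wins v0 p \<longleftrightarrow> (\<exists>k. breaker_wins_within v0 k p)"

definition winning_strategy :: "vertex \<Rightarrow> nat \<Rightarrow> nat \<Rightarrow> strategy \<Rightarrow> bool" where
  "winning_strategy v0 m b \<sigma> \<longleftrightarrow>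
     breaker_strategy m b \<sigma> \<and> (\<forall>p. play_against m b \<sigma> p \<longrightarrow> breaker_wins v0 p)"

end

theory Submission
  imports Defs
begin

text \<open>
  Put \<open>k = 2 * m - b\<close> (truncated), so that \<open>b \<ge> 2 * m - k\<close> and \<open>m \<ge> 14 * k + 22\<close>. Breaker has
  confined \<open>v\<close> once he owns every edge of the boundary of some finite set \<open>X\<close> with \<open>v \<in> X\<close>, and he
  can complete such a boundary exactly when no Maker edge crosses it and at most \<open>b\<close> of its
  edges are missing (\<open>capturable\<close>).

  A connected piece with \<open>e\<close> Maker edges fits into a rectangle whose boundary has
  at most \<open>2 * e + 4\<close> edges, and this can be attained. Enclosing Maker therefore costs two edges for
  each of hers plus \<open>4\<close>, which leaves Breaker \<open>k + 4\<close> edges short in the first round, \<open>2 * k + 4\<close> in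
  the second and \<open>3 * k + 4\<close> in the third.

  He makes up for this with walls. Breaker completes a rectangular boundary except for a few adjacent edges, the gates,
  and chooses the gates so that Maker has to pass along a finished wall. A region that rests on a wall
  need not be closed on that side, so that moving along the wall costs Breaker one edge instead of
  two for each edge of Maker.

  \<^enum> After Maker's first claim let \<open>R\<close> be the least rectangle around \<open>v\<close> that no Maker edge leaves. Up
    to a reflection it is at least as wide as high, hence long. Breaker claims its boundary except
    for \<open>g \<le> k + 4\<close> gates in the top side, placed with \<open>3 * k + 4\<close> columns of wall to their left and
    at least \<open>2 * k + 4\<close> to their right (\<open>wins_from_wide_rect\<close>).
  \<^enum> Maker's second claim escapes through the gates. Let \<open>A\<close> be the least rectangle standing on the
    top side of \<open>R\<close>, over the gates, that no Maker edge leaves inside the columns of \<open>R\<close>. If Maker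
    leaves \<open>R \<union> A\<close> at all, then \<open>A\<close> reaches an end of the wall, Maker has spent at least \<open>2 * k + 4\<close>
    edges on sideways movement, and Breaker completes an enclosure now. If not, then
    either \<open>R \<union> A\<close> can be enclosed now, or \<open>A\<close> is a high and nearly straight tower; Breaker then
    claims the boundary of \<open>R \<union> A\<close> except for at most \<open>2 * k + 4\<close> gates at the foot of the left side of \<open>A\<close>
    (\<open>second_round\<close>).
  \<^enum> These gates lie in a corner between two long walls, the tower and the top side of \<open>R\<close>. Inside the
    corner the least rectangle \<open>A'\<close> costs only one edge for each edge of Maker, and leaving the
    corner requires her to follow one of the walls to its end, which saves Breaker the missing
    \<open>3 * k + 4\<close> edges (\<open>third_round\<close>).

  Two counting arguments carry this. In a least rectangle, every gap between two adjacent columns or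
  rows (outside the core which it has to contain) is crossed by a Maker edge, since the rectangle could
  be cut there otherwise; so its dimensions are paid for by Maker edges inside it (\<open>tight_rect\<close>,
  \<open>extension_rect\<close>). Whatever Maker does beyond the rectangles is absorbed vertex by vertex at a cost of
  two boundary edges for each of her edges (\<open>growth\<close>). Both count all of Maker's edges, whether or not
  they are connected to \<open>v\<close>, so edges claimed far away in advance need no separate treatment.
\<close>

section \<open>Edges of the lattice\<close>

definition hedge :: "int \<Rightarrow> int \<Rightarrow> edge" where
  "hedge x y = {(x, y), (x + 1, y)}"

definition vedge :: "int \<Rightarrow> int \<Rightarrow> edge" where
  "vedge x y = {(x, y), (x, y + 1)}"

lemma lattice_edges_iff: "e \<in> lattice_edges \<longleftrightarrow> (\<exists>x y. e = hedge x y \<or> e = vedge x y)"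
proof
  assume "e \<in> lattice_edges"
  then obtain x y x' y' where e: "e = {(x, y), (x', y')}" "\<bar>x - x'\<bar> + \<bar>y - y'\<bar> = 1"
    by (auto simp: lattice_edges_def lattice_adj_def)
  then have "(x' = x + 1 \<and> y' = y) \<or> (x = x' + 1 \<and> y' = y) \<or> (x' = x \<and> y' = y + 1)
    \<or> (x' = x \<and> y = y' + 1)"
    by presburger
  then show "\<exists>x y. e = hedge x y \<or> e = vedge x y"
    using e(1) by (auto simp: hedge_def vedge_def insert_commute)
next
  assume "\<exists>x y. e = hedge x y \<or> e = vedge x y"
  then obtain x y where "e = {(x, y), (x + 1, y)} \<or> e = {(x, y), (x, y + 1)}"
    by (auto simp: hedge_def vedge_def)
  moreover have "lattice_adj (x, y) (x + 1, y)" "lattice_adj (x, y) (x, y + 1)"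
    by (simp_all add: lattice_adj_def)
  ultimately show "e \<in> lattice_edges"
    unfolding lattice_edges_def by blast
qed

lemma hedge_eq_iff [simp]: "hedge x y = hedge x' y' \<longleftrightarrow> x = x' \<and> y = y'"
  by (auto simp: hedge_def doubleton_eq_iff)

lemma vedge_eq_iff [simp]: "vedge x y = vedge x' y' \<longleftrightarrow> x = x' \<and> y = y'"
  by (auto simp: vedge_def doubleton_eq_iff)

lemma hedge_neq_vedge [simp]: "hedge x y \<noteq> vedge x' y'" "vedge x' y' \<noteq> hedge x y"
  by (auto simp: hedge_def vedge_def doubleton_eq_iff)

lemma hedge_in [simp]: "hedge x y \<in> lattice_edges" and vedge_in [simp]: "vedge x y \<in> lattice_edges"
  using lattice_edges_iff by blast+

lemma infinite_lattice_edges: "infinite lattice_edges"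
proof
  assume "finite lattice_edges"
  then have "finite (range (\<lambda>x. hedge x 0))"
    by (rule rev_finite_subset) auto
  then show False
    by (simp add: finite_image_iff inj_on_def)
qed

lemma lattice_edge_obtain_vertices:
  assumes "e \<in> lattice_edges"
  obtains u v where "e = {u, v}"
  using assms by (auto simp: lattice_edges_def)

lemma finite_lattice_edge: "e \<in> lattice_edges \<Longrightarrow> finite e"
  by (auto simp: lattice_edges_def)

section \<open>Edge boundaries\<close>

definition bd :: "vertex set \<Rightarrow> edge set" where
  "bd X = {e \<in> lattice_edges. e \<inter> X \<noteq> {} \<and> \<not> e \<subseteq> X}"

definition star :: "vertex \<Rightarrow> edge set" where
  "star v = {hedge (fst v) (snd v), hedge (fst v - 1) (snd v),
             vedge (fst v) (snd v), vedge (fst v) (snd v - 1)}"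

lemma mem_star:
  assumes "e \<in> lattice_edges" "v \<in> e"
  shows "e \<in> star v"
proof -
  from assms(1) consider x y where "e = hedge x y" | x y where "e = vedge x y"
    by (auto simp: lattice_edges_iff)
  then show ?thesis
  proof cases
    case 1
    then have "v = (x, y) \<or> v = (x + 1, y)"
      using assms(2) by (simp add: hedge_def)
    then show ?thesis
      unfolding 1 star_def by auto
  next
    case 2
    then have "v = (x, y) \<or> v = (x, y + 1)"
      using assms(2) by (simp add: vedge_def)
    then show ?thesis
      unfolding 2 star_def by auto
  qed
qed

lemma card_star: "card (star v) \<le> 4"
proof -
  let ?es = "[hedge (fst v) (snd v), hedge (fst v - 1) (snd v),
              vedge (fst v) (snd v), vedge (fst v) (snd v - 1)]"
  have "star v = set ?es"
    by (simp add: star_def)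
  then show ?thesis
    using card_length[of ?es] by simp
qed

lemma finite_star [simp]: "finite (star v)"
  by (simp add: star_def)

lemma finite_bd: "finite X \<Longrightarrow> finite (bd X)"
  by (rule finite_subset[of _ "\<Union>v\<in>X. star v"]) (auto simp: bd_def intro: mem_star)

definition sealed :: "vertex \<Rightarrow> edge set \<Rightarrow> bool" where
  "sealed v B \<longleftrightarrow> (\<exists>X. finite X \<and> v \<in> X \<and> bd X \<subseteq> B)"

lemma sealed_encloses:
  assumes "sealed v B"
  shows "encloses v B"
proof -
  obtain X where X: "finite X" "v \<in> X" "bd X \<subseteq> B"
    using assms by (auto simp: sealed_def)
  have "u \<in> X" if "(v, u) \<in> joined (lattice_edges - B)" for u
    using that unfolding joined_def
  proof (induction rule: rtrancl_induct)
    case (step y z)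
    then show ?case
      using X(3) by (auto simp: bd_def)
  qed (rule X(2))
  then have "{u. (v, u) \<in> joined (lattice_edges - B)} \<subseteq> X"
    by blast
  then show ?thesis
    using X(1) finite_subset encloses_iff_finite_component by blast
qed

text \<open>The sets \<open>X\<close> that Breaker could seal off right now: all of the boundary is still available to
  him, and the missing part fits into one claim.\<close>

definition capturable :: "vertex \<Rightarrow> nat \<Rightarrow> edge set \<Rightarrow> edge set \<Rightarrow> bool" where
  "capturable v b M B \<longleftrightarrow> (\<exists>X. finite X \<and> v \<in> X \<and> bd X \<inter> M = {} \<and> card (bd X - B) \<le> b)"

lemma capturable_if_gates_untouched:
  assumes "finite X" "v \<in> X" "bd X - G \<subseteq> B" "M \<inter> B = {}" "M \<inter> G = {}" "finite G" "card G \<le> b"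
  shows "capturable v b M B"
proof -
  have "bd X \<inter> M = {}"
    using assms(3-5) by blast
  moreover have "card (bd X - B) \<le> card G"
    by (rule card_mono) (use assms(3,6) in blast)+
  ultimately show ?thesis
    unfolding capturable_def using assms(1,2,7) by (intro exI[of _ X]) simp
qed

text \<open>A Maker edge \<open>{u, w}\<close> across the boundary of \<open>X\<close> disappears from it when \<open>w\<close> is added, and the at
  most three other edges at \<open>w\<close> are the only new boundary edges.\<close>

lemma absorb_vertex:
  assumes "finite X" "u \<in> X" "w \<notin> X" "{u, w} \<in> lattice_edges - B"
  shows "card (bd (insert w X) - B) \<le> card (bd X - B) + 2"
proof -
  let ?e = "{u, w}"
  have e: "?e \<in> bd X - B" "?e \<in> star w"
    using assms by (auto simp: bd_def intro: mem_star)
  have "bd (insert w X) - B \<subseteq> (bd X - B - {?e}) \<union> (star w - {?e})"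
    using assms by (auto simp: bd_def intro: mem_star)
  then have "card (bd (insert w X) - B) \<le> card ((bd X - B - {?e}) \<union> (star w - {?e}))"
    by (intro card_mono) (use assms(1) finite_bd in auto)
  also have "\<dots> \<le> card (bd X - B - {?e}) + card (star w - {?e})"
    by (rule card_Un_le)
  also have "card (star w - {?e}) \<le> 3"
    using card_star[of w] e(2) by (simp add: card_Diff_singleton)
  also have "card (bd X - B - {?e}) + 3 = card (bd X - B) + 2"
    using e(1) finite_bd[OF assms(1)] card_Suc_Diff1[of "bd X - B" ?e] by simp
  finally show ?thesis
    by simp
qed

text \<open>Absorbing the outer ends of crossing Maker edges one at a time. Each absorbed vertex uses up a
  Maker edge that was not inside \<open>X\<close> before, so the process ends and its cost is bounded by the
  number of those edges.\<close>

lemma growth: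
  assumes "finite X" "finite M" "M \<subseteq> lattice_edges" "M \<inter> B = {}"
  shows "\<exists>Y. finite Y \<and> X \<subseteq> Y \<and> bd Y \<inter> M = {} \<and>
     card (bd Y - B) \<le> card (bd X - B) + 2 * card {e \<in> M. \<not> e \<subseteq> X}"
  using assms(1)
proof (induction "card {e \<in> M. \<not> e \<subseteq> X}" arbitrary: X rule: less_induct)
  case less
  show ?case
  proof (cases "bd X \<inter> M = {}")
    case True
    then show ?thesis
      using less.prems by auto
  next
    case False
    then obtain e where e: "e \<in> bd X" "e \<in> M"
      by blast
    then obtain u w where uw: "e = {u, w}" "u \<in> X" "w \<notin> X"
    proof -
      have "e \<in> lattice_edges"
        using e(1) by (simp add: bd_def)
      then obtain p q where pq: "e = {p, q}"
        by (rule lattice_edge_obtain_vertices)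
      consider "p \<in> X" "q \<notin> X" | "q \<in> X" "p \<notin> X"
        using e(1) unfolding pq bd_def by blast
      then show thesis
        using that[of p q] that[of q p] pq by cases (simp_all add: insert_commute)
    qed
    let ?X = "insert w X"
    have "{e' \<in> M. \<not> e' \<subseteq> ?X} \<subset> {e' \<in> M. \<not> e' \<subseteq> X}"
    proof
      show "{e' \<in> M. \<not> e' \<subseteq> ?X} \<subseteq> {e' \<in> M. \<not> e' \<subseteq> X}"
        by blast
      have "e \<in> {e' \<in> M. \<not> e' \<subseteq> X}" "e \<notin> {e' \<in> M. \<not> e' \<subseteq> ?X}"
        using e(2) uw by simp_all
      then show "{e' \<in> M. \<not> e' \<subseteq> ?X} \<noteq> {e' \<in> M. \<not> e' \<subseteq> X}"
        by metis
    qed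
    then have less1: "card {e' \<in> M. \<not> e' \<subseteq> ?X} < card {e' \<in> M. \<not> e' \<subseteq> X}"
      by (intro psubset_card_mono) (use assms(2) in auto)
    obtain Y where Y: "finite Y" "?X \<subseteq> Y" "bd Y \<inter> M = {}"
      "card (bd Y - B) \<le> card (bd ?X - B) + 2 * card {e' \<in> M. \<not> e' \<subseteq> ?X}"
      using less.hyps[OF less1 finite.insertI[OF less.prems]] by blast
    have "card (bd ?X - B) \<le> card (bd X - B) + 2"
      using absorb_vertex[of X u w B] less.prems uw e assms(3,4) by blast
    with Y(4) less1 have
      "card (bd Y - B) \<le> card (bd X - B) + 2 * card {e' \<in> M. \<not> e' \<subseteq> X}"
      by linarith
    moreover have "X \<subseteq> Y"
      using Y(2) by simp
    ultimately show ?thesis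
      using Y(1,3) by blast
  qed
qed

section \<open>Rectangles\<close>

definition rect :: "int \<Rightarrow> int \<Rightarrow> int \<Rightarrow> int \<Rightarrow> vertex set" where
  "rect x1 x2 y1 y2 = {x1..x2} \<times> {y1..y2}"

lemma finite_rect [simp]: "finite (rect x1 x2 y1 y2)"
  by (simp add: rect_def)

lemma hedge_bd_iff: "hedge x y \<in> bd X \<longleftrightarrow> ((x, y) \<in> X) \<noteq> ((x + 1, y) \<in> X)"
  unfolding bd_def using hedge_in[of x y] by (simp add: hedge_def) blast

lemma vedge_bd_iff: "vedge x y \<in> bd X \<longleftrightarrow> ((x, y) \<in> X) \<noteq> ((x, y + 1) \<in> X)"
  unfolding bd_def using vedge_in[of x y] by (simp add: vedge_def) blast

lemma hedge_subset_iff: "hedge x y \<subseteq> X \<longleftrightarrow> (x, y) \<in> X \<and> (x + 1, y) \<in> X"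
  by (simp add: hedge_def)

lemma vedge_subset_iff: "vedge x y \<subseteq> X \<longleftrightarrow> (x, y) \<in> X \<and> (x, y + 1) \<in> X"
  by (simp add: vedge_def)

lemma mem_rect: "(x, y) \<in> rect x1 x2 y1 y2 \<longleftrightarrow> x1 \<le> x \<and> x \<le> x2 \<and> y1 \<le> y \<and> y \<le> y2"
  by (auto simp: rect_def)

lemma bd_rect_cases:
  assumes "e \<in> bd (rect x1 x2 y1 y2)"
  obtains (left) y where "e = hedge (x1 - 1) y" "y \<in> {y1..y2}"
  | (right) y where "e = hedge x2 y" "y \<in> {y1..y2}"
  | (bottom) x where "e = vedge x (y1 - 1)" "x \<in> {x1..x2}"
  | (top) x where "e = vedge x y2" "x \<in> {x1..x2}"
proof -
  from assms consider x y where "e = hedge x y" | x y where "e = vedge x y"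
    by (auto simp: bd_def lattice_edges_iff)
  then show thesis
  proof cases
    case 1
    then have "y \<in> {y1..y2}" "x = x1 - 1 \<or> x = x2"
      using assms by (auto simp: hedge_bd_iff mem_rect)
    then show thesis
      using 1 left right by blast
  next
    case 2
    then have "x \<in> {x1..x2}" "y = y1 - 1 \<or> y = y2"
      using assms by (auto simp: vedge_bd_iff mem_rect)
    then show thesis
      using 2 bottom top by blast
  qed
qed

text \<open>Distinct gaps are crossed by distinct edges.\<close>

lemma gap_count:
  assumes "finite E" "\<And>c. c \<in> C \<Longrightarrow> \<exists>y. hedge c y \<in> E" "\<And>d. d \<in> D \<Longrightarrow> \<exists>x. vedge x d \<in> E"
    and "finite C" "finite D"
  shows "card C + card D \<le> card E"
proof -
  obtain f g where f: "\<And>c. c \<in> C \<Longrightarrow> hedge c (f c) \<in> E" and g: "\<And>d. d \<in> D \<Longrightarrow> vedge (g d) d \<in> E"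
    using assms(2,3) by metis
  let ?P = "(\<lambda>c. hedge c (f c)) ` C" and ?Q = "(\<lambda>d. vedge (g d) d) ` D"
  have "card C = card ?P" "card D = card ?Q"
    by (auto simp: card_image inj_on_def)
  moreover have "card ?P + card ?Q = card (?P \<union> ?Q)"
    by (intro card_Un_disjoint[symmetric]) (use assms(4,5) in auto)
  moreover have "card (?P \<union> ?Q) \<le> card E"
    by (intro card_mono) (use assms(1) f g in auto)
  ultimately show ?thesis
    by simp
qed

definition inside :: "edge set \<Rightarrow> vertex set \<Rightarrow> nat" where
  "inside M X = card {e \<in> M. e \<subseteq> X}"

text \<open>For a core \<open>[k1, k2] \<times> [j1, j2]\<close> inside a frame \<open>[o1, o2] \<times> [p1, p2]\<close>, take a least rectangle between
  the two whose boundary is crossed by no edge of \<open>M\<close> that stays in the frame; the frame itself is a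
  candidate. Cutting it at a column or row gap outside the core gives a smaller
  rectangle, so some edge of \<open>M\<close> in the frame crosses the new boundary. That edge cannot cross the old
  boundary, and therefore it crosses the gap inside the rectangle. Edges of \<open>M\<close> that leave the
  frame are ignored here; they are the exits that the later rounds have to discuss.\<close>

lemma tight_rect:
  assumes "finite M" "M \<subseteq> lattice_edges"
    and K: "o1 \<le> k1" "k1 \<le> k2" "k2 \<le> o2" "p1 \<le> j1" "j1 \<le> j2" "j2 \<le> p2"
  obtains x1 x2 y1 y2 where
    "o1 \<le> x1" "x1 \<le> k1" "k2 \<le> x2" "x2 \<le> o2" "p1 \<le> y1" "y1 \<le> j1" "j2 \<le> y2" "y2 \<le> p2"
    "\<And>e. e \<in> M \<Longrightarrow> e \<subseteq> rect o1 o2 p1 p2 \<Longrightarrow> e \<notin> bd (rect x1 x2 y1 y2)"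
    "(x2 - x1) - (k2 - k1) + ((y2 - y1) - (j2 - j1)) \<le> int (inside M (rect x1 x2 y1 y2))"
proof -
  define ok where "ok = (\<lambda>(x1, x2, y1, y2).
    o1 \<le> x1 \<and> x1 \<le> k1 \<and> k2 \<le> x2 \<and> x2 \<le> o2 \<and> p1 \<le> y1 \<and> y1 \<le> j1 \<and> j2 \<le> y2 \<and> y2 \<le> p2 \<and>
    (\<forall>e\<in>M. e \<subseteq> rect o1 o2 p1 p2 \<longrightarrow> e \<notin> bd (rect x1 x2 y1 y2)))"
  define size where "size = (\<lambda>(x1, x2, y1, y2). nat (x2 - x1 + (y2 - y1)))"
  have "ok (o1, o2, p1, p2)"
    using K by (auto simp: ok_def bd_def)
  then obtain q where "ok q" "\<And>q'. ok q' \<Longrightarrow> size q \<le> size q'"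
    using ex_has_least_nat[of ok _ size] by blast
  moreover obtain x1 x2 y1 y2 where q: "q = (x1, x2, y1, y2)"
    by (cases q) auto
  ultimately have ok: "ok (x1, x2, y1, y2)"
    and least: "\<And>a1 a2 b1 b2. ok (a1, a2, b1, b2) \<Longrightarrow> size (x1, x2, y1, y2) \<le> size (a1, a2, b1, b2)"
    by auto
  let ?A = "rect x1 x2 y1 y2"
  let ?E = "{e \<in> M. e \<subseteq> ?A}"
  have bounds: "o1 \<le> x1" "x1 \<le> k1" "k2 \<le> x2" "x2 \<le> o2" "p1 \<le> y1" "y1 \<le> j1" "j2 \<le> y2" "y2 \<le> p2"
    and good: "\<And>e. e \<in> M \<Longrightarrow> e \<subseteq> rect o1 o2 p1 p2 \<Longrightarrow> e \<notin> bd ?A"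
    using ok by (auto simp: ok_def)
  have cut: "\<exists>e\<in>?E. e \<in> bd (rect a1 a2 b1 b2)"
    if sub: "x1 \<le> a1" "a1 \<le> k1" "k2 \<le> a2" "a2 \<le> x2" "y1 \<le> b1" "b1 \<le> j1" "j2 \<le> b2" "b2 \<le> y2"
      "a2 - a1 + (b2 - b1) < x2 - x1 + (y2 - y1)" for a1 a2 b1 b2
  proof -
    have "\<not> ok (a1, a2, b1, b2)"
      using least[of a1 a2 b1 b2] sub K by (auto simp: size_def)
    then obtain e where e: "e \<in> M" "e \<subseteq> rect o1 o2 p1 p2" "e \<in> bd (rect a1 a2 b1 b2)"
      using sub bounds by (auto simp: ok_def)
    have "rect a1 a2 b1 b2 \<subseteq> ?A"
      using sub by (auto simp: rect_def)
    then have "e \<subseteq> ?A"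
      using good[OF e(1,2)] e(3) by (auto simp: bd_def)
    then show ?thesis
      using e by blast
  qed
  have left: "\<exists>y. hedge c y \<in> ?E" if c: "c \<in> {x1..<k1}" for c
  proof -
    obtain e where e: "e \<in> ?E" "e \<in> bd (rect (c + 1) x2 y1 y2)"
      using cut[of "c + 1" x2 y1 y2] c bounds K by auto
    from e(2) show ?thesis
      by (cases rule: bd_rect_cases)
        (use e(1) c in \<open>auto simp: hedge_subset_iff vedge_subset_iff mem_rect\<close>)
  qed
  have right: "\<exists>y. hedge c y \<in> ?E" if c: "c \<in> {k2..<x2}" for c
  proof -
    obtain e where e: "e \<in> ?E" "e \<in> bd (rect x1 c y1 y2)"
      using cut[of x1 c y1 y2] c bounds K by auto
    from e(2) show ?thesis
      by (cases rule: bd_rect_cases)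
        (use e(1) c in \<open>auto simp: hedge_subset_iff vedge_subset_iff mem_rect\<close>)
  qed
  have down: "\<exists>x. vedge x c \<in> ?E" if c: "c \<in> {y1..<j1}" for c
  proof -
    obtain e where e: "e \<in> ?E" "e \<in> bd (rect x1 x2 (c + 1) y2)"
      using cut[of x1 x2 "c + 1" y2] c bounds K by auto
    from e(2) show ?thesis
      by (cases rule: bd_rect_cases)
        (use e(1) c in \<open>auto simp: hedge_subset_iff vedge_subset_iff mem_rect\<close>)
  qed
  have up: "\<exists>x. vedge x c \<in> ?E" if c: "c \<in> {j2..<y2}" for c
  proof -
    obtain e where e: "e \<in> ?E" "e \<in> bd (rect x1 x2 y1 c)"
      using cut[of x1 x2 y1 c] c bounds K by auto
    from e(2) show ?thesis
      by (cases rule: bd_rect_cases)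
        (use e(1) c in \<open>auto simp: hedge_subset_iff vedge_subset_iff mem_rect\<close>)
  qed
  have "card ({x1..<k1} \<union> {k2..<x2}) + card ({y1..<j1} \<union> {j2..<y2}) \<le> inside M ?A"
    unfolding inside_def
    by (rule gap_count) (use assms(1) left right down up in auto)
  moreover have "card ({x1..<k1} \<union> {k2..<x2}) = card {x1..<k1} + card {k2..<x2}"
    "card ({y1..<j1} \<union> {j2..<y2}) = card {y1..<j1} + card {j2..<y2}"
    by (rule card_Un_disjoint; use K in auto)+
  ultimately have "(x2 - x1) - (k2 - k1) + ((y2 - y1) - (j2 - j1)) \<le> int (inside M ?A)"
    using bounds by simp
  then show thesis
    using that[OF bounds good] by blast
qed

text \<open>The situation after Maker has broken out of a region \<open>X\<close> whose boundary Breaker owns except for the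
  gates \<open>G\<close>. As the core contains the outer ends of all gates, no gate is on the boundary of the
  extended region, and the edges that Breaker still lacks belong to the new rectangle and do not
  touch \<open>X\<close>: the sides along which the rectangle rests on \<open>X\<close> are free. A Maker edge that crosses the
  boundary of the extended region has to leave the frame.\<close>

lemma extension_rect:
  assumes M: "finite M" "M \<subseteq> lattice_edges" "M \<inter> B = {}"
    and K: "o1 \<le> k1" "k1 \<le> k2" "k2 \<le> o2" "p1 \<le> j1" "j1 \<le> j2" "j2 \<le> p2"
    and X: "bd X - G \<subseteq> B"
    and G: "\<And>e. e \<in> G \<Longrightarrow> e \<subseteq> X \<union> rect k1 k2 j1 j2"
  obtains x1 x2 y1 y2 where
    "o1 \<le> x1" "x1 \<le> k1" "k2 \<le> x2" "x2 \<le> o2" "p1 \<le> y1" "y1 \<le> j1" "j2 \<le> y2" "y2 \<le> p2"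
    "(x2 - x1) - (k2 - k1) + ((y2 - y1) - (j2 - j1)) \<le> int (inside M (rect x1 x2 y1 y2))"
    "\<And>e. e \<in> bd (X \<union> rect x1 x2 y1 y2) - B \<Longrightarrow> e \<in> bd (rect x1 x2 y1 y2) \<and> e \<inter> X = {}"
    "\<And>e. e \<in> M \<Longrightarrow> e \<in> bd (X \<union> rect x1 x2 y1 y2) \<Longrightarrow> \<not> e \<subseteq> rect o1 o2 p1 p2"
proof (rule tight_rect[OF M(1,2) K])
  fix x1 x2 y1 y2
  let ?A = "rect x1 x2 y1 y2"
  assume bounds: "o1 \<le> x1" "x1 \<le> k1" "k2 \<le> x2" "x2 \<le> o2" "p1 \<le> y1" "y1 \<le> j1" "j2 \<le> y2" "y2 \<le> p2"
    and good: "\<And>e. e \<in> M \<Longrightarrow> e \<subseteq> rect o1 o2 p1 p2 \<Longrightarrow> e \<notin> bd ?A"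
    and count: "(x2 - x1) - (k2 - k1) + ((y2 - y1) - (j2 - j1)) \<le> int (inside M ?A)"
  have sub: "rect k1 k2 j1 j2 \<subseteq> ?A"
    using bounds by (auto simp: rect_def)
  have new: "e \<in> bd ?A \<and> e \<inter> X = {}" if e: "e \<in> bd (X \<union> ?A) - B" for e
  proof -
    have "e \<inter> X = {}"
    proof (rule ccontr)
      assume "e \<inter> X \<noteq> {}"
      then have "e \<in> bd X"
        using e by (auto simp: bd_def)
      then have "e \<in> G"
        using X e by blast
      then have "e \<subseteq> X \<union> ?A"
        using G sub by blast
      then show False
        using e by (auto simp: bd_def)
    qed
    then show ?thesis
      using e by (auto simp: bd_def)
  qed
  moreover have "\<not> e \<subseteq> rect o1 o2 p1 p2" if "e \<in> M" "e \<in> bd (X \<union> ?A)" for e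
    using new[of e] good[of e] that M(3) by blast
  ultimately show thesis
    using that[OF bounds count] by blast
qed

lemma inside_mono: "finite M' \<Longrightarrow> M \<subseteq> M' \<Longrightarrow> inside M X \<le> inside M' X"
  unfolding inside_def by (intro card_mono) (simp, blast)

lemma inside_outside:
  assumes "finite M"
  shows "inside M X + card {e \<in> M. \<not> e \<subseteq> X} = card M"
proof -
  have "card ({e \<in> M. e \<subseteq> X} \<union> {e \<in> M. \<not> e \<subseteq> X}) = inside M X + card {e \<in> M. \<not> e \<subseteq> X}"
    unfolding inside_def using assms by (intro card_Un_disjoint) (simp_all, blast)
  moreover have "{e \<in> M. e \<subseteq> X} \<union> {e \<in> M. \<not> e \<subseteq> X} = M"
    by blast
  ultimately show ?thesis
    by simp
qed

text \<open>The edge \<open>e\<close> by which Maker passes from \<open>X\<close> to \<open>A\<close> is inside neither part; counting it pays for the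
  first row or column of \<open>A\<close>, which is not a gap inside \<open>A\<close>.\<close>

lemma inside_Un:
  assumes "finite M" "M \<subseteq> lattice_edges" "X \<inter> A = {}" "e \<in> M" "e \<in> bd X" "e \<subseteq> X \<union> A"
  shows "inside M X + inside M A + 1 \<le> inside M (X \<union> A)"
proof -
  let ?P = "{e \<in> M. e \<subseteq> X}" and ?Q = "{e \<in> M. e \<subseteq> A}"
  have ne: "e' \<noteq> {}" if "e' \<in> M" for e'
  proof -
    have "e' \<in> lattice_edges"
      using that assms(2) by blast
    then show ?thesis
      by (rule lattice_edge_obtain_vertices) blast
  qed
  have "?P \<inter> ?Q = {}"
    using assms(3) ne by blast
  then have "card (?P \<union> ?Q) = card ?P + card ?Q"
    using assms(1) by (intro card_Un_disjoint) simp_all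
  moreover have "e \<notin> ?P \<union> ?Q"
    using assms(3,5) unfolding bd_def by blast
  ultimately have "card (insert e (?P \<union> ?Q)) = card ?P + card ?Q + 1"
    using assms(1) by simp
  moreover have "card (insert e (?P \<union> ?Q)) \<le> card {e \<in> M. e \<subseteq> X \<union> A}"
    by (intro card_mono) (use assms(1,4,6) in \<open>simp, blast\<close>)
  ultimately show ?thesis
    by (simp add: inside_def)
qed

lemma card_hedge_image [simp]: "card (hedge x ` Y) = card Y"
  by (simp add: card_image inj_on_def)

lemma card_vedge_image [simp]: "card ((\<lambda>x. vedge x y) ` X) = card X"
  by (simp add: card_image inj_on_def)

section \<open>The third round: escaping from a corner\<close>

text \<open>Position after Maker's third claim: \<open>R = rect l r bt T\<close> carries the tower \<open>A = rect x1 x2 (T + 1) y2\<close>, and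
  the \<open>g2\<close> gates are the lowest edges of the left side of \<open>A\<close>. Maker's new region is caught by a
  rectangle in the corner bounded by the columns \<open>l\<close> to \<open>x1 - 1\<close> and the rows of the tower, of which only
  the left and the top side have to be closed. If Maker leaves the corner, that rectangle extends either to
  the left end of the wall, over \<open>x1 - l\<close> columns, or to the top of the tower, and one edge is saved for each
  of these columns or rows. Both numbers are large enough: \<open>a - l \<ge> 3 * k + 4\<close>, and the columns
  between \<open>x1\<close> and \<open>a\<close> have cost Maker sideways edges in the second round already.\<close>

lemma third_round:
  fixes l r bt T a g x1 x2 y2 g2 :: int and m b k :: nat
  assumes M: "finite M" "M \<subseteq> lattice_edges" "M \<inter> B = {}" "card M \<le> 3 * m"
    and v: "v \<in> rect l r bt T"
    and B: "bd (rect l r bt T \<union> rect x1 x2 (T + 1) y2) - hedge (x1 - 1) ` {T + 1..T + g2} \<subseteq> B"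
    and place: "l \<le> x1" "x1 \<le> a" "3 * int k + 4 \<le> a - l" "a + g - 1 \<le> x2" "x2 \<le> r" "T < y2"
    and g: "1 \<le> g" "g = 2 * ((r - l + 1) + (T - bt + 1)) - int b" "g \<le> int k + 4"
    and g2: "1 \<le> g2" "g2 = (x2 - x1 + 1) + 2 * (y2 - T) - int b"
      "g2 + (x2 - x1 + 1 - g) \<le> 2 * int k + 4"
    and count: "(r - l) + (T - bt) + 1 + (x2 - x1 + 1 - g) + (y2 - T - 1)
      \<le> int (inside M (rect l r bt T \<union> rect x1 x2 (T + 1) y2))"
    and k: "2 * m \<le> b + k" "14 * k + 22 \<le> m"
  shows "capturable v b M B"
proof -
  let ?X = "rect l r bt T \<union> rect x1 x2 (T + 1) y2"
  let ?G = "hedge (x1 - 1) ` {T + 1..T + g2}"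
  have ki: "2 * int m \<le> int b + int k" "14 * int k + 22 \<le> int m" "0 \<le> int k"
    using k by linarith+
  have bt: "bt \<le> T"
    using v by (cases v) (simp add: mem_rect)
  \<comment> \<open>Otherwise the tower would be low and its boundary would have been affordable in the second round.\<close>
  have tall: "g2 + 3 * int k + 4 \<le> y2 - T"
  proof -
    have "g2 + (x2 - x1 + 1) \<le> 3 * int k + 8" "27 * int k + 44 \<le> int b"
      using g(3) g2(3) ki by linarith+
    then have "2 * (g2 + 3 * int k + 4) \<le> 2 * (y2 - T)"
      using g2(2) ki(3) by smt
    then show ?thesis
      by simp
  qed
  show ?thesis
  proof (cases "M \<inter> ?G = {}")
    case True
    have "capturable v b M B"
    proof (rule capturable_if_gates_untouched[OF _ _ B M(3) True])
      show "card ?G \<le> b"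
        using g2 g ki place by simp
    qed (use v in simp_all)
    then show ?thesis .
  next
    case False
    then obtain y0 where y0: "hedge (x1 - 1) y0 \<in> M" "T + 1 \<le> y0" "y0 \<le> T + g2"
      by auto
    have K: "l \<le> x1 - 1" "x1 - 1 \<le> x1 - 1" "T + 1 \<le> T + 1" "T + 1 \<le> T + g2" "T + g2 \<le> y2"
      using place g g2 tall ki by linarith+
    have G: "e \<subseteq> ?X \<union> rect (x1 - 1) (x1 - 1) (T + 1) (T + g2)" if e: "e \<in> ?G" for e
    proof -
      obtain y where "e = hedge (x1 - 1) y" "T + 1 \<le> y" "y \<le> T + g2"
        using e by auto
      then show ?thesis
        using K place g by (simp add: hedge_subset_iff mem_rect)
    qed
    obtain x3 x4 y4 y3 where A:
      "l \<le> x3" "x3 \<le> x1 - 1" "x1 - 1 \<le> x4" "x4 \<le> x1 - 1" "T + 1 \<le> y4" "y4 \<le> T + 1"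
      "T + g2 \<le> y3" "y3 \<le> y2"
      "(x4 - x3) - ((x1 - 1) - (x1 - 1)) + ((y3 - y4) - (T + g2 - (T + 1)))
        \<le> int (inside M (rect x3 x4 y4 y3))"
      and new: "\<And>e. e \<in> bd (?X \<union> rect x3 x4 y4 y3) - B \<Longrightarrow>
        e \<in> bd (rect x3 x4 y4 y3) \<and> e \<inter> ?X = {}"
      and exit: "\<And>e. e \<in> M \<Longrightarrow> e \<in> bd (?X \<union> rect x3 x4 y4 y3) \<Longrightarrow>
        \<not> e \<subseteq> rect l (x1 - 1) (T + 1) y2"
      using extension_rect[OF M(1-3) K(1,2) order_refl K(3-5) B G] by blast
    have eqs: "x4 = x1 - 1" "y4 = T + 1"
      using A by linarith+
    let ?A = "rect x3 (x1 - 1) (T + 1) y3"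
    let ?Y = "?X \<union> ?A"
    have sides: "e \<in> hedge (x3 - 1) ` {T + 1..y3} \<union> (\<lambda>x. vedge x y3) ` {x3..x1 - 1}"
      if e: "e \<in> bd ?Y - B" for e
    proof -
      have "e \<in> bd ?A" and X: "e \<inter> ?X = {}"
        using new[of e] e by (simp_all add: eqs)
      then show ?thesis
      proof (cases rule: bd_rect_cases)
        case (right y)
        then have "(x1, y) \<in> e" "(x1, y) \<in> ?X"
          using A place g by (auto simp: hedge_def mem_rect)
        then show ?thesis
          using X by blast
      next
        case (bottom x)
        then have "(x, T) \<in> e" "(x, T) \<in> ?X"
          using A place g bt by (auto simp: vedge_def mem_rect)
        then show ?thesis
          using X by blast
      qed auto
    qed
    have "card (bd ?Y - B) \<le> card (hedge (x3 - 1) ` {T + 1..y3} \<union> (\<lambda>x. vedge x y3) ` {x3..x1 - 1})"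
      by (rule card_mono) (use sides in blast)+
    also have "\<dots> \<le> card (hedge (x3 - 1) ` {T + 1..y3}) + card ((\<lambda>x. vedge x y3) ` {x3..x1 - 1})"
      by (rule card_Un_le)
    finally have cost: "int (card (bd ?Y - B)) \<le> (y3 - T) + (x1 - x3)"
      using A g2 by simp
    have "inside M ?X + inside M ?A + 1 \<le> inside M ?Y"
    proof (rule inside_Un[OF M(1,2) _ y0(1)])
      show "?X \<inter> ?A = {}"
        by (auto simp: mem_rect)
      show "hedge (x1 - 1) y0 \<in> bd ?X"
        using y0 K place g by (auto simp: hedge_bd_iff mem_rect)
      show "hedge (x1 - 1) y0 \<subseteq> ?Y"
        using y0 K A place g by (auto simp: hedge_subset_iff mem_rect)
    qed
    moreover have "inside M ?Y + card {e \<in> M. \<not> e \<subseteq> ?Y} = card M"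
      by (rule inside_outside[OF M(1)])
    ultimately have total: "int (inside M ?X) + int (inside M ?A) + 1 + int (card {e \<in> M. \<not> e \<subseteq> ?Y})
      \<le> 3 * int m"
      using M(4) by linarith
    have Acount: "(x1 - 1 - x3) + (y3 - T - g2) \<le> int (inside M ?A)"
      using A(9) by (simp add: eqs)
    show ?thesis
    proof (cases "bd ?Y \<inter> M = {}")
      case True
      have "int (card (bd ?Y - B)) \<le> int b"
      proof -
        have "int (inside M ?X) + int (inside M ?A) + 1 \<le> 3 * int m"
          using total by linarith
        then show ?thesis
          using cost Acount count g(2) g2 ki place(2,4) by smt
      qed
      then show ?thesis
        unfolding capturable_def using v True by (intro exI[of _ ?Y]) simp
    next
      case False
      then obtain e where e: "e \<in> bd ?Y" "e \<in> M"
        by blast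
      then have "\<not> e \<subseteq> rect l (x1 - 1) (T + 1) y2"
        using exit by (simp add: eqs)
      moreover have "e \<in> hedge (x3 - 1) ` {T + 1..y3} \<union> (\<lambda>x. vedge x y3) ` {x3..x1 - 1}"
        using sides e M(3) by blast
      ultimately have wall: "x3 = l \<or> y3 = y2"
      proof (elim UnE imageE)
        fix y
        assume "\<not> e \<subseteq> rect l (x1 - 1) (T + 1) y2" "e = hedge (x3 - 1) y" "y \<in> {T + 1..y3}"
        then show ?thesis
          using A by (simp add: hedge_subset_iff mem_rect)
      next
        fix x
        assume "\<not> e \<subseteq> rect l (x1 - 1) (T + 1) y2" "e = vedge x y3" "x \<in> {x3..x1 - 1}"
        then show ?thesis
          using A g2 by (simp add: vedge_subset_iff mem_rect)
      qed
      obtain Z where Z: "finite Z" "?Y \<subseteq> Z" "bd Z \<inter> M = {}"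
        "card (bd Z - B) \<le> card (bd ?Y - B) + 2 * card {e \<in> M. \<not> e \<subseteq> ?Y}"
        using growth[of ?Y M B] M by auto
      have grow: "int (card (bd Z - B))
          \<le> int (card (bd ?Y - B)) + 2 * int (card {e \<in> M. \<not> e \<subseteq> ?Y})"
        using Z(4) by linarith
      have "int (card (bd Z - B)) \<le> int b"
        using wall
      proof
        assume "x3 = l"
        then show ?thesis
          using grow cost total Acount count g(2) g2(2) ki(1) place(2-4) A(7) by smt
      next
        assume "y3 = y2"
        then show ?thesis
          using grow cost total Acount count g(2) g2 ki(1,3) A(2) place(2,4) tall by smt
      qed
      then show ?thesis
        unfolding capturable_def using v Z by (intro exI[of _ Z]) auto
    qed
  qed
qed

section \<open>The second round: escaping from a wall\<close>

text \<open>Position after Maker's second claim: the gates are the edges above \<open>a, \<dots>, a + g - 1\<close> in the top side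
  of \<open>R = rect l r bt T\<close>. In the second alternative of the conclusion, Breaker closes the tower except for its
  \<open>g2\<close> gates; the width \<open>x2 - x1 + 1 - g\<close> in excess of the gates enters the bound on \<open>g2\<close> because the
  tower rests on the wall, so that every sideways edge of Maker saves Breaker one edge.\<close>

lemma second_round:
  fixes l r bt T a g :: int and m b k :: nat
  assumes M: "finite M" "M \<subseteq> lattice_edges" "M \<inter> B = {}" "card M \<le> 2 * m"
    and v: "v \<in> rect l r bt T"
    and B: "bd (rect l r bt T) - (\<lambda>x. vedge x T) ` {a..a + g - 1} \<subseteq> B"
    and place: "3 * int k + 4 \<le> a - l" "a + g - 1 + 2 * int k + 4 \<le> r"
    and g: "1 \<le> g" "g = 2 * ((r - l + 1) + (T - bt + 1)) - int b" "g \<le> int k + 4"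
    and count: "(r - l) + (T - bt) \<le> int (inside M (rect l r bt T))"
    and k: "2 * m \<le> b + k" "14 * k + 22 \<le> m"
  shows "capturable v b M B \<or>
    (\<exists>x1 x2 y2 g2. l \<le> x1 \<and> x1 \<le> a \<and> a + g - 1 \<le> x2 \<and> x2 \<le> r \<and> T < y2 \<and>
      1 \<le> g2 \<and> g2 = (x2 - x1 + 1) + 2 * (y2 - T) - int b \<and>
      g2 + (x2 - x1 + 1 - g) \<le> 2 * int k + 4 \<and>
      (r - l) + (T - bt) + 1 + (x2 - x1 + 1 - g) + (y2 - T - 1)
        \<le> int (inside M (rect l r bt T \<union> rect x1 x2 (T + 1) y2)) \<and>
      bd (rect l r bt T \<union> rect x1 x2 (T + 1) y2) \<inter> M = {} \<and>
      card (bd (rect l r bt T \<union> rect x1 x2 (T + 1) y2) - B - hedge (x1 - 1) ` {T + 1..T + g2}) \<le> b)"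
proof -
  let ?X = "rect l r bt T"
  let ?G = "(\<lambda>x. vedge x T) ` {a..a + g - 1}"
  have ki: "2 * int m \<le> int b + int k" "14 * int k + 22 \<le> int m" "0 \<le> int k"
    using k by linarith+
  have bt: "bt \<le> T"
    using v by (cases v) (simp add: mem_rect)
  show ?thesis
  proof (cases "M \<inter> ?G = {}")
    case True
    have "capturable v b M B"
    proof (rule capturable_if_gates_untouched[OF _ _ B M(3) True])
      show "card ?G \<le> b"
        using g ki by simp
    qed (use v in simp_all)
    then show ?thesis ..
  next
    case False
    then obtain x0 where x0: "vedge x0 T \<in> M" "a \<le> x0" "x0 \<le> a + g - 1"
      by auto
    \<comment> \<open>A row above all of Maker's edges, so that the frame below can be left only sideways.\<close>
    have "finite (snd ` \<Union>M)"
      using M(1) finite_lattice_edge[OF subsetD[OF M(2)]] by (intro finite_imageI finite_Union)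
    then obtain N where N: "\<And>y. y \<in> snd ` \<Union>M \<Longrightarrow> y \<le> N"
      using bdd_above_finite unfolding bdd_above_def by metis
    have K: "l \<le> a" "a \<le> a + g - 1" "a + g - 1 \<le> r" "T + 1 \<le> T + 1" "T + 1 \<le> max N (T + 1)"
      using place g by auto
    have G: "e \<subseteq> ?X \<union> rect a (a + g - 1) (T + 1) (T + 1)" if e: "e \<in> ?G" for e
    proof -
      obtain x where "e = vedge x T" "a \<le> x" "x \<le> a + g - 1"
        using e by auto
      then show ?thesis
        using K bt by (simp add: vedge_subset_iff mem_rect)
    qed
    obtain x1 x2 y1 y2 where A:
      "l \<le> x1" "x1 \<le> a" "a + g - 1 \<le> x2" "x2 \<le> r" "T + 1 \<le> y1" "y1 \<le> T + 1"
      "T + 1 \<le> y2" "y2 \<le> max N (T + 1)"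
      "(x2 - x1) - ((a + g - 1) - a) + ((y2 - y1) - (T + 1 - (T + 1)))
        \<le> int (inside M (rect x1 x2 y1 y2))"
      and new: "\<And>e. e \<in> bd (?X \<union> rect x1 x2 y1 y2) - B \<Longrightarrow>
        e \<in> bd (rect x1 x2 y1 y2) \<and> e \<inter> ?X = {}"
      and exit: "\<And>e. e \<in> M \<Longrightarrow> e \<in> bd (?X \<union> rect x1 x2 y1 y2) \<Longrightarrow>
        \<not> e \<subseteq> rect l r (T + 1) (max N (T + 1))"
      using extension_rect[OF M(1-3) K(1-4) order_refl K(5) B G] by blast
    have eqs: "y1 = T + 1"
      using A by linarith
    let ?A = "rect x1 x2 (T + 1) y2"
    let ?Y = "?X \<union> ?A"
    let ?L = "hedge (x1 - 1) ` {T + 1..y2}" and ?R = "hedge x2 ` {T + 1..y2}"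
      and ?U = "(\<lambda>x. vedge x y2) ` {x1..x2}"
    have sides: "e \<in> ?L \<union> (?R \<union> ?U)" if e: "e \<in> bd ?Y - B" for e
    proof -
      have "e \<in> bd ?A" and X: "e \<inter> ?X = {}"
        using new[of e] e by (simp_all add: eqs)
      then show ?thesis
      proof (cases rule: bd_rect_cases)
        case (bottom x)
        then have "(x, T) \<in> e" "(x, T) \<in> ?X"
          using A place g bt by (auto simp: vedge_def mem_rect)
        then show ?thesis
          using X by blast
      qed auto
    qed
    have cost_minus: "card (bd ?Y - B - S) \<le> card (?L - S) + (card ?R + card ?U)" for S
    proof -
      have "card (bd ?Y - B - S) \<le> card ((?L - S) \<union> (?R \<union> ?U))"
        by (rule card_mono) (use sides in blast)+
      also have "\<dots> \<le> card (?L - S) + card (?R \<union> ?U)"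
        by (rule card_Un_le)
      also have "card (?R \<union> ?U) \<le> card ?R + card ?U"
        by (rule card_Un_le)
      finally show ?thesis
        by simp
    qed
    have cost: "int (card (bd ?Y - B)) \<le> (x2 - x1 + 1) + 2 * (y2 - T)"
      using cost_minus[of "{}"] A g by simp
    have "inside M ?X + inside M ?A + 1 \<le> inside M ?Y"
    proof (rule inside_Un[OF M(1,2) _ x0(1)])
      show "?X \<inter> ?A = {}"
        by (auto simp: mem_rect)
      show "vedge x0 T \<in> bd ?X"
        using x0 K bt by (auto simp: vedge_bd_iff mem_rect)
      show "vedge x0 T \<subseteq> ?Y"
        using x0 K A bt by (auto simp: vedge_subset_iff mem_rect)
    qed
    moreover have "(x2 - x1 + 1 - g) + (y2 - T - 1) \<le> int (inside M ?A)"
      using A(9) by (simp add: eqs)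
    ultimately have Ycount: "(r - l) + (T - bt) + 1 + (x2 - x1 + 1 - g) + (y2 - T - 1)
        \<le> int (inside M ?Y)"
      using count by linarith
    have total: "int (inside M ?Y) + int (card {e \<in> M. \<not> e \<subseteq> ?Y}) \<le> 2 * int m"
      using inside_outside[OF M(1), of ?Y] M(4) by linarith
    show ?thesis
    proof (cases "bd ?Y \<inter> M = {}")
      case False
      then obtain e where e: "e \<in> bd ?Y" "e \<in> M"
        by blast
      then have out: "\<not> e \<subseteq> rect l r (T + 1) (max N (T + 1))"
        using exit by (simp add: eqs)
      have "e \<in> ?L \<union> (?R \<union> ?U)"
        using sides e M(3) by blast
      then have "x1 = l \<or> x2 = r"
      proof (elim UnE imageE)
        fix y
        assume "e = hedge (x1 - 1) y" "y \<in> {T + 1..y2}"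
        then show ?thesis
          using out A g by (simp add: hedge_subset_iff mem_rect)
      next
        fix y
        assume "e = hedge x2 y" "y \<in> {T + 1..y2}"
        then show ?thesis
          using out A g by (simp add: hedge_subset_iff mem_rect)
      next
        fix x
        assume x: "e = vedge x y2" "x \<in> {x1..x2}"
        then have "(x, y2 + 1) \<in> \<Union>M"
          using e(2) by (auto simp: vedge_def)
        then have "y2 + 1 \<le> N"
          using N[of "y2 + 1"] by force
        then show ?thesis
          using x out A by (simp add: vedge_subset_iff mem_rect)
      qed
      \<comment> \<open>At the end of the wall Maker has paid for at least the shorter of the two stretches beside the gates.\<close>
      then have wall: "2 * int k + 4 \<le> x2 - x1 + 1 - g"
        using A place by linarith
      obtain Z where Z: "finite Z" "?Y \<subseteq> Z" "bd Z \<inter> M = {}"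
        "card (bd Z - B) \<le> card (bd ?Y - B) + 2 * card {e \<in> M. \<not> e \<subseteq> ?Y}"
        using growth[of ?Y M B] M by auto
      have grow: "int (card (bd Z - B))
          \<le> int (card (bd ?Y - B)) + 2 * int (card {e \<in> M. \<not> e \<subseteq> ?Y})"
        using Z(4) by linarith
      have "int (card (bd Z - B)) \<le> int b"
        using wall grow cost total Ycount g(2) ki(1) by smt
      then show ?thesis
        unfolding capturable_def using v Z by (intro disjI1 exI[of _ Z]) auto
    next
      case closed: True
      define g2 where "g2 = (x2 - x1 + 1) + 2 * (y2 - T) - int b"
      show ?thesis
      proof (cases "1 \<le> g2")
        case False
        then have "int (card (bd ?Y - B)) \<le> int b"
          using cost by (simp add: g2_def)
        then show ?thesis
          unfolding capturable_def using v closed by (intro disjI1 exI[of _ ?Y]) simp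
      next
        case True
        have small: "g2 + (x2 - x1 + 1 - g) \<le> 2 * int k + 4"
        proof -
          have "int (inside M ?Y) \<le> 2 * int m"
            using total by linarith
          then show ?thesis
            using Ycount g(2) ki(1) unfolding g2_def by smt
        qed
        \<comment> \<open>The gates fit into the side of the tower, since a tower with \<open>g2 > 0\<close> is high.\<close>
        have fits: "g2 \<le> y2 - T"
        proof -
          have "g2 + (x2 - x1 + 1) \<le> 3 * int k + 8" "27 * int k + 44 \<le> int b"
            using small g(3) ki by linarith+
          moreover have "2 * y2 - 2 * T = g2 + int b - (x2 - x1 + 1)"
            by (simp add: g2_def)
          ultimately show ?thesis
            using ki(3) by linarith
        qed
        let ?H = "hedge (x1 - 1) ` {T + 1..T + g2}"
        have "?L - ?H = hedge (x1 - 1) ` ({T + 1..y2} - {T + 1..T + g2})"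
          by (rule image_set_diff[symmetric]) (simp add: inj_on_def)
        also have "{T + 1..y2} - {T + 1..T + g2} = {T + g2 + 1..y2}"
          using True by auto
        finally have "?L - ?H = hedge (x1 - 1) ` {T + g2 + 1..y2}" .
        then have "int (card (bd ?Y - B - ?H)) \<le> int b"
          using cost_minus[of ?H] A g fits unfolding g2_def by simp
        then show ?thesis
          using closed small Ycount A True g2_def
          by (intro disjI2 exI[of _ x1] exI[of _ x2] exI[of _ y2] exI[of _ g2]) simp
      qed
    qed
  qed
qed

section \<open>Legal replies and won positions\<close>

lemma legal_reply:
  assumes "finite C" "S \<subseteq> lattice_edges - C" "finite S" "card S \<le> b"
  shows "\<exists>B'. legal_claim b C B' \<and> S \<subseteq> B'"
proof -
  have "infinite (lattice_edges - (C \<union> S))"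
    using infinite_lattice_edges assms(1,3) by (intro Diff_infinite_finite) simp_all
  then obtain T where T: "finite T" "card T = b - card S" "T \<subseteq> lattice_edges - (C \<union> S)"
    using infinite_arbitrarily_large by blast
  have "card (S \<union> T) = b"
    using assms(3,4) T by (subst card_Un_disjoint) auto
  then have "legal_claim b C (S \<union> T)"
    using assms T by (auto simp: legal_claim_def)
  then show ?thesis
    by blast
qed

lemma reply_boundary:
  assumes "finite X" "finite C" "card (bd X - B - G) \<le> b" "bd X \<inter> M = {}" "C = M \<union> B"
  shows "\<exists>B'. legal_claim b C B' \<and> bd X - G \<subseteq> B \<union> B'"
proof -
  have "\<exists>B'. legal_claim b C B' \<and> bd X - B - G \<subseteq> B'"
  proof (rule legal_reply)
    show "bd X - B - G \<subseteq> lattice_edges - C"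
      using assms(4,5) unfolding bd_def by blast
  qed (use assms finite_bd in simp_all)
  then show ?thesis
    by blast
qed

text \<open>The value of a position, from Breaker's point of view, with \<open>n\<close> rounds to go; \<open>M\<close> and \<open>B\<close> are the sets
  of all edges that the players own.\<close>

primrec wins_in :: "nat \<Rightarrow> vertex \<Rightarrow> nat \<Rightarrow> nat \<Rightarrow> edge set \<Rightarrow> edge set \<Rightarrow> bool" where
  "wins_in 0 v m b M B \<longleftrightarrow> sealed v B"
| "wins_in (Suc n) v m b M B \<longleftrightarrow> sealed v B \<or>
    (\<forall>M'. legal_claim m (M \<union> B) M' \<longrightarrow>
      (\<exists>B'. legal_claim b (M \<union> M' \<union> B) B' \<and> wins_in n v m b (M \<union> M') (B \<union> B')))"

lemma sealed_wins_in: "sealed v B \<Longrightarrow> wins_in n v m b M B"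
  by (cases n) simp_all

lemma capturable_reply:
  assumes "capturable v b M B" "finite M" "finite B"
  shows "\<exists>B'. legal_claim b (M \<union> B) B' \<and> wins_in n v m b M (B \<union> B')"
proof -
  obtain X where X: "finite X" "v \<in> X" "bd X \<inter> M = {}" "card (bd X - B) \<le> b"
    using assms(1) by (auto simp: capturable_def)
  then obtain B' where B': "legal_claim b (M \<union> B) B'" "bd X - {} \<subseteq> B \<union> B'"
    using reply_boundary[of X "M \<union> B" B "{}" b M] assms(2,3) by auto
  then have "sealed v (B \<union> B')"
    unfolding sealed_def using X by blast
  then show ?thesis
    using B'(1) sealed_wins_in by blast
qed

lemma legal_claim_facts:
  assumes "legal_claim n C S"
  shows "finite S" "S \<subseteq> lattice_edges" "S \<inter> C = {}" "card S = n"
  using assms by (auto simp: legal_claim_def)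

section \<open>The first round: choosing the gates\<close>

text \<open>The choice of the gates. The width needed for the two stretches of wall and the gates is at most
  \<open>(3 * k + 4) + (2 * k + 4) + (k + 4) = 6 * k + 12\<close>. It is available: if \<open>R\<close> cannot be enclosed at
  once, then \<open>4 * (r - l + 1) \<ge> 2 * ((r - l + 1) + (T - bt + 1)) > b \<ge> 2 * m - k \<ge> 27 * k + 44\<close>.\<close>

lemma wins_from_wide_rect:
  fixes l r bt T :: int and m b k :: nat
  assumes M: "legal_claim m {} M"
    and v: "v \<in> rect l r bt T"
    and closed: "bd (rect l r bt T) \<inter> M = {}"
    and count: "(r - l) + (T - bt) \<le> int (inside M (rect l r bt T))"
    and wide: "T - bt \<le> r - l"
    and k: "2 * m \<le> b + k" "14 * k + 22 \<le> m"
  shows "\<exists>B. legal_claim b M B \<and> wins_in 2 v m b M B"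
proof -
  let ?R = "rect l r bt T"
  define g where "g = 2 * ((r - l + 1) + (T - bt + 1)) - int b"
  define a where "a = l + 3 * int k + 4"
  have ki: "2 * int m \<le> int b + int k" "14 * int k + 22 \<le> int m" "0 \<le> int k"
    using k by linarith+
  have M1: "finite M" "M \<subseteq> lattice_edges" "card M = m"
    using legal_claim_facts[OF M] by simp_all
  have ord: "l \<le> r" "bt \<le> T"
    using v by (cases v; simp add: mem_rect)+
  let ?L = "hedge (l - 1) ` {bt..T}" and ?R' = "hedge r ` {bt..T}"
    and ?D = "(\<lambda>x. vedge x (bt - 1)) ` {l..r}" and ?U = "(\<lambda>x. vedge x T) ` {l..r}"
  have sides: "e \<in> ?L \<union> ?R' \<union> ?D \<union> ?U" if "e \<in> bd ?R" for e
    using that by (cases rule: bd_rect_cases) auto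
  have cost: "card (bd ?R - S) \<le> card ?L + card ?R' + card ?D + card (?U - S)" for S
  proof -
    have "card (bd ?R - S) \<le> card ((?L \<union> ?R' \<union> ?D) \<union> (?U - S))"
      by (rule card_mono) (use sides in blast)+
    also have "\<dots> \<le> card (?L \<union> ?R' \<union> ?D) + card (?U - S)"
      by (rule card_Un_le)
    also have "card (?L \<union> ?R' \<union> ?D) \<le> card (?L \<union> ?R') + card ?D"
      by (rule card_Un_le)
    also have "card (?L \<union> ?R') \<le> card ?L + card ?R'"
      by (rule card_Un_le)
    finally show ?thesis
      by simp
  qed
  have inside_le: "int (inside M ?R) \<le> int m"
    using inside_outside[OF M1(1), of ?R] M1(3) by linarith
  show ?thesis
  proof (cases "1 \<le> g")
    case False
    have "int (card (bd ?R - {})) \<le> int b"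
      using cost[of "{}"] False ord unfolding g_def by simp
    then have "capturable v b M {}"
      unfolding capturable_def using v closed by (intro exI[of _ ?R]) simp
    then show ?thesis
      using capturable_reply[of v b M "{}" 2 m] M1 by simp
  next
    case True
    have g_le: "g \<le> int k + 4"
      using inside_le count ki(1) unfolding g_def by smt
    have "6 * int k + 12 \<le> r - l + 1"
    proof -
      have "int b + 1 \<le> 2 * r - 2 * l + 2 * T - 2 * bt + 4"
        using True by (simp add: g_def)
      then show ?thesis
        using wide ki by linarith
    qed
    then have room: "a + g - 1 + 2 * int k + 4 \<le> r"
      using g_le unfolding a_def by linarith
    let ?G = "(\<lambda>x. vedge x T) ` {a..a + g - 1}"
    have sub: "{a..a + g - 1} \<subseteq> {l..r}"
      using room ki(3) unfolding a_def by auto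
    have "?U - ?G = (\<lambda>x. vedge x T) ` ({l..r} - {a..a + g - 1})"
      by (rule image_set_diff[symmetric]) (simp add: inj_on_def)
    then have "card (?U - ?G) = card ({l..r} - {a..a + g - 1})"
      by simp
    also have "\<dots> = card {l..r} - card {a..a + g - 1}"
      using sub by (intro card_Diff_subset) auto
    finally have "int (card (bd ?R - ?G)) \<le> int b"
      using cost[of ?G] True ord room ki(3) unfolding g_def a_def by simp
    then obtain B where B: "legal_claim b M B" "bd ?R - ?G \<subseteq> B"
      using reply_boundary[of ?R M "{}" ?G b M] closed M1 by auto
    have "\<exists>B'. legal_claim b (M \<union> M' \<union> B) B' \<and> wins_in 1 v m b (M \<union> M') (B \<union> B')"
      if M': "legal_claim m (M \<union> B) M'" for M'
    proof -
      let ?M = "M \<union> M'"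
      have fin: "finite ?M" "?M \<subseteq> lattice_edges" "finite B"
        using legal_claim_facts[OF M'] legal_claim_facts[OF B(1)] M1 by simp_all
      have disj: "?M \<inter> B = {}"
        using legal_claim_facts(3)[OF M'] legal_claim_facts(3)[OF B(1)] by blast
      have "card ?M \<le> 2 * m"
        using card_Un_le[of M M'] legal_claim_facts(4)[OF M'] M1(3) by simp
      moreover have "(r - l) + (T - bt) \<le> int (inside ?M ?R)"
        using count inside_mono[OF fin(1), of M ?R] by simp
      moreover have "3 * int k + 4 \<le> a - l"
        by (simp add: a_def)
      ultimately consider "capturable v b ?M B"
        | x1 x2 y2 g2 where "l \<le> x1" "x1 \<le> a" "a + g - 1 \<le> x2" "x2 \<le> r" "T < y2"
          "1 \<le> g2" "g2 = (x2 - x1 + 1) + 2 * (y2 - T) - int b"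
          "g2 + (x2 - x1 + 1 - g) \<le> 2 * int k + 4"
          "(r - l) + (T - bt) + 1 + (x2 - x1 + 1 - g) + (y2 - T - 1)
             \<le> int (inside ?M (?R \<union> rect x1 x2 (T + 1) y2))"
          "bd (?R \<union> rect x1 x2 (T + 1) y2) \<inter> ?M = {}"
          "card (bd (?R \<union> rect x1 x2 (T + 1) y2) - B - hedge (x1 - 1) ` {T + 1..T + g2}) \<le> b"
        using second_round[OF fin(1,2) disj _ v B(2) _ room True g_def g_le _ k] by blast
      then show ?thesis
      proof cases
        case 1
        then show ?thesis
          using capturable_reply fin by blast
      next
        case 2
        let ?X = "?R \<union> rect x1 x2 (T + 1) y2"
        let ?H = "hedge (x1 - 1) ` {T + 1..T + g2}"
        obtain B' where B': "legal_claim b (?M \<union> B) B'" "bd ?X - ?H \<subseteq> B \<union> B'"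
          using reply_boundary[OF _ _ 2(11,10) refl] fin by auto
        have "\<exists>B''. legal_claim b (?M \<union> M'' \<union> (B \<union> B')) B'' \<and>
            wins_in 0 v m b (?M \<union> M'') (B \<union> B' \<union> B'')"
          if M'': "legal_claim m (?M \<union> (B \<union> B')) M''" for M''
        proof (rule capturable_reply)
          have fin': "finite (?M \<union> M'')" "?M \<union> M'' \<subseteq> lattice_edges"
            using fin legal_claim_facts[OF M''] by simp_all
          have disj': "(?M \<union> M'') \<inter> (B \<union> B') = {}"
            using legal_claim_facts(3)[OF M''] legal_claim_facts(3)[OF B'(1)] disj by blast
          have card': "card (?M \<union> M'') \<le> 3 * m"
            using card_Un_le[of ?M M''] legal_claim_facts(4)[OF M''] \<open>card ?M \<le> 2 * m\<close> by simp
          have "int (inside ?M ?X) \<le> int (inside (?M \<union> M'') ?X)"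
            using inside_mono[OF fin'(1), of ?M ?X] by simp
          with 2(9) have count': "(r - l) + (T - bt) + 1 + (x2 - x1 + 1 - g) + (y2 - T - 1)
             \<le> int (inside (?M \<union> M'') ?X)"
            by linarith
          show "capturable v b (?M \<union> M'') (B \<union> B')"
            by (rule third_round[OF fin' disj' card' v B'(2) 2(1,2) \<open>3 * int k + 4 \<le> a - l\<close>
                  2(3-5) True g_def g_le 2(6-8) count' k])
          show "finite (?M \<union> M'')" "finite (B \<union> B')"
            using fin' fin legal_claim_facts(1)[OF B'(1)] by simp_all
        qed
        then show ?thesis
          using B'(1) by auto
      qed
    qed
    then show ?thesis
      using B(1) by (auto simp: numeral_2_eq_2)
  qed
qed

section \<open>Reflection in the diagonal\<close>

definition flip :: "edge set \<Rightarrow> edge set" where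
  "flip E = image prod.swap ` E"

lemma swap_swap_image [simp]: "prod.swap ` prod.swap ` X = X"
  by (simp add: image_image)

lemma flip_flip [simp]: "flip (flip E) = E"
  by (simp add: flip_def image_image)

lemma flip_Un: "flip (A \<union> B) = flip A \<union> flip B"
  by (simp add: flip_def image_Un)

lemma mem_flip: "e \<in> flip E \<longleftrightarrow> prod.swap ` e \<in> E"
  unfolding flip_def by (metis (no_types, lifting) image_iff swap_swap_image)

lemma inj_flip: "inj (image prod.swap)"
  by (metis injI swap_swap_image)

lemma swap_hedge: "prod.swap ` hedge x y = vedge y x" and swap_vedge: "prod.swap ` vedge x y = hedge y x"
  by (simp_all add: hedge_def vedge_def)

lemma swap_lattice_edge: "e \<in> lattice_edges \<Longrightarrow> prod.swap ` e \<in> lattice_edges"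
  by (auto simp: lattice_edges_iff swap_hedge swap_vedge)

lemma legal_claim_flip:
  assumes "legal_claim n C S"
  shows "legal_claim n (flip C) (flip S)"
proof -
  have "card (flip S) = card S"
    unfolding flip_def by (rule card_image[OF inj_on_subset[OF inj_flip]]) simp
  moreover have "finite (flip S)"
    using assms by (simp add: flip_def legal_claim_def)
  moreover have "flip S \<subseteq> lattice_edges - flip C"
  proof
    fix e
    assume "e \<in> flip S"
    then have "prod.swap ` e \<in> lattice_edges - C"
      using assms by (auto simp: mem_flip legal_claim_def)
    then show "e \<in> lattice_edges - flip C"
      using swap_lattice_edge[of "prod.swap ` e"] by (simp add: mem_flip)
  qed
  ultimately show ?thesis
    using assms by (simp add: legal_claim_def)
qed

lemma mem_bd_swap:
  assumes "e \<in> bd (prod.swap ` X)"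
  shows "prod.swap ` e \<in> bd X"
proof -
  have "prod.swap ` e \<inter> X \<noteq> {}" "\<not> prod.swap ` e \<subseteq> X"
    using assms by (force simp: bd_def)+
  then show ?thesis
    using assms swap_lattice_edge by (simp add: bd_def)
qed

lemma sealed_flip:
  assumes "sealed v B"
  shows "sealed (prod.swap v) (flip B)"
proof -
  obtain X where X: "finite X" "v \<in> X" "bd X \<subseteq> B"
    using assms by (auto simp: sealed_def)
  have "bd (prod.swap ` X) \<subseteq> flip B"
    using mem_bd_swap X(3) by (fastforce simp: mem_flip)
  then show ?thesis
    unfolding sealed_def using X by blast
qed

lemma wins_in_flip:
  "wins_in n v m b M B \<Longrightarrow> wins_in n (prod.swap v) m b (flip M) (flip B)"
proof (induction n arbitrary: M B)
  case 0
  then show ?case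
    by (simp add: sealed_flip)
next
  case (Suc n)
  show ?case
  proof (cases "sealed v B")
    case True
    then show ?thesis
      by (simp add: sealed_flip)
  next
    case False
    have "\<exists>B'. legal_claim b (flip M \<union> M' \<union> flip B) B' \<and>
        wins_in n (prod.swap v) m b (flip M \<union> M') (flip B \<union> B')"
      if M': "legal_claim m (flip M \<union> flip B) M'" for M'
    proof -
      have "legal_claim m (M \<union> B) (flip M')"
        using legal_claim_flip[OF M'] by (simp add: flip_Un)
      then obtain B' where B': "legal_claim b (M \<union> flip M' \<union> B) B'"
        "wins_in n v m b (M \<union> flip M') (B \<union> B')"
        using Suc.prems False by auto
      show ?thesis
        using legal_claim_flip[OF B'(1)] Suc.IH[OF B'(2)] by (auto simp: flip_Un)
    qed
    then show ?thesis
      by simp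
  qed
qed

lemma swap_rect: "prod.swap ` rect x1 x2 y1 y2 = rect y1 y2 x1 x2"
  by (force simp: rect_def)

lemma inside_flip: "inside (flip M) (prod.swap ` X) = inside M X"
proof -
  have "{e \<in> flip M. e \<subseteq> prod.swap ` X} = image prod.swap ` {e \<in> M. e \<subseteq> X}"
  proof (rule set_eqI)
    fix e
    have "e \<subseteq> prod.swap ` X \<longleftrightarrow> prod.swap ` e \<subseteq> X"
      by (metis image_mono swap_swap_image)
    then show "e \<in> {e \<in> flip M. e \<subseteq> prod.swap ` X} \<longleftrightarrow> e \<in> image prod.swap ` {e \<in> M. e \<subseteq> X}"
      using mem_flip[of e M] mem_flip[of e "{e \<in> M. e \<subseteq> X}"] by (simp add: flip_def)
  qed
  then show ?thesis
    unfolding inside_def by (simp add: card_image[OF inj_on_subset[OF inj_flip]])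
qed


section \<open>The initial position\<close>

text \<open>With the core \<open>{v}\<close> and a frame that contains all of Maker's edges, a tight rectangle has no exits at all.
  If it is higher than wide, Breaker's answer comes from the reflected position.\<close>

lemma wins_from_start:
  fixes m b k :: nat
  assumes k: "2 * m \<le> b + k" "14 * k + 22 \<le> m"
  shows "wins_in 3 v m b {} {}"
proof -
  have "\<exists>B. legal_claim b M B \<and> wins_in 2 v m b M B" if M: "legal_claim m {} M" for M
  proof -
    have M1: "finite M" "M \<subseteq> lattice_edges"
      using legal_claim_facts[OF M] by simp_all
    have "finite (insert v (\<Union>M))"
      using M1(1) finite_lattice_edge[OF subsetD[OF M1(2)]]
      by (intro finite.insertI finite_Union)
    then have "finite (abs ` (fst ` insert v (\<Union>M) \<union> snd ` insert v (\<Union>M)))"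
      by blast
    then obtain N where N: "\<And>z. z \<in> fst ` insert v (\<Union>M) \<union> snd ` insert v (\<Union>M) \<Longrightarrow> \<bar>z\<bar> \<le> N"
      using bdd_above_finite unfolding bdd_above_def by (metis imageI)
    obtain p q where v: "v = (p, q)"
      by (cases v) auto
    have big: "u \<in> rect (- N) N (- N) N" if u: "u \<in> insert v (\<Union>M)" for u
    proof (cases u)
      case (Pair x y)
      have "\<bar>fst u\<bar> \<le> N" "\<bar>snd u\<bar> \<le> N"
        using u by (intro N UnI1 UnI2 imageI; assumption)+
      then show ?thesis
        by (simp add: Pair mem_rect abs_le_iff)
    qed
    have pq: "- N \<le> p" "p \<le> N" "- N \<le> q" "q \<le> N"
      using big[of v] by (simp_all add: v mem_rect)
    obtain l r bt T where R: "l \<le> p" "p \<le> r" "bt \<le> q" "q \<le> T"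
      and good: "\<And>e. e \<in> M \<Longrightarrow> e \<subseteq> rect (- N) N (- N) N \<Longrightarrow> e \<notin> bd (rect l r bt T)"
      and count: "(r - l) - (p - p) + ((T - bt) - (q - q)) \<le> int (inside M (rect l r bt T))"
      using tight_rect[OF M1 pq(1) order_refl pq(2,3) order_refl pq(4)] by metis
    have vR: "v \<in> rect l r bt T"
      using R by (simp add: v mem_rect)
    have closed: "bd (rect l r bt T) \<inter> M = {}"
      using good big by blast
    show ?thesis
    proof (cases "T - bt \<le> r - l")
      case True
      then show ?thesis
        using wins_from_wide_rect[OF M vR closed _ _ k] count by simp
    next
      case False
      have "legal_claim m {} (flip M)"
        using legal_claim_flip[OF M] by (simp add: flip_def)
      moreover have "prod.swap v \<in> rect bt T l r"
        using R by (simp add: v mem_rect)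
      moreover have "bd (rect bt T l r) \<inter> flip M = {}"
        using mem_bd_swap[of _ "rect l r bt T"] closed by (fastforce simp: swap_rect mem_flip)
      moreover have "(T - bt) + (r - l) \<le> int (inside (flip M) (rect bt T l r))"
        using count inside_flip[of M "rect l r bt T"] by (simp add: swap_rect)
      ultimately obtain B where B: "legal_claim b (flip M) B" "wins_in 2 (prod.swap v) m b (flip M) B"
        using wins_from_wide_rect[of m "flip M" "prod.swap v" bt T l r b k] False k by auto
      show ?thesis
        using legal_claim_flip[OF B(1)] wins_in_flip[OF B(2)] by auto
    qed
  qed
  then show ?thesis
    by (simp add: numeral_3_eq_3 numeral_2_eq_2)
qed

section \<open>From positions to strategies\<close>

lemma finite_claimed:
  assumes "legal_history m b h"
  shows "finite (claimed h)"
  using assms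
proof induction
  case start
  then show ?case
    by (simp add: claimed_def maker_edges_def breaker_edges_def)
next
  case (round h M B)
  then show ?case
    by (simp add: claimed_def maker_edges_def breaker_edges_def legal_claim_def)
qed

lemma edges_rounds_Suc:
  "maker_edges (rounds p (Suc n)) = maker_edges (rounds p n) \<union> fst (p n)"
  "breaker_edges (rounds p (Suc n)) = breaker_edges (rounds p n) \<union> snd (p n)"
  by (auto simp: rounds_def maker_edges_def breaker_edges_def)

lemma legal_history_snoc:
  assumes "legal_history m b (h @ [q])"
  shows "legal_claim m (claimed h) (fst q)"
  using assms by (cases rule: legal_history.cases) auto

definition good_reply :: "vertex \<Rightarrow> nat \<Rightarrow> nat \<Rightarrow> nat \<Rightarrow> history \<Rightarrow> edge set \<Rightarrow> edge set \<Rightarrow> bool" where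
  "good_reply v N m b h M B \<longleftrightarrow> legal_claim b (claimed h \<union> M) B \<and>
     wins_in (N - Suc (length h)) v m b (maker_edges h \<union> M) (breaker_edges h \<union> B)"

text \<open>Breaker plays some reply that keeps the position won, if there is one, and any legal reply otherwise,
  since a strategy has to answer in every legal situation.\<close>

lemma strategy_if_wins_in:
  assumes "wins_in N v m b {} {}"
  shows "\<exists>\<sigma>. winning_strategy v m b \<sigma> \<and> (\<forall>p. play_against m b \<sigma> p \<longrightarrow> breaker_wins_within v N p)"
proof -
  define \<sigma> :: strategy where "\<sigma> = (\<lambda>h M. if \<exists>B. good_reply v N m b h M B
    then SOME B. good_reply v N m b h M B else SOME B. legal_claim b (claimed h \<union> M) B)"
  have good: "good_reply v N m b h M (\<sigma> h M)" if "\<exists>B. good_reply v N m b h M B" for h M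
    using someI_ex[OF that] that by (simp add: \<sigma>_def)
  have legal: "breaker_strategy m b \<sigma>"
    unfolding breaker_strategy_def
  proof (intro allI impI, elim conjE)
    fix h M
    assume h: "legal_history m b h" "legal_claim m (claimed h) M"
    then have "finite (claimed h \<union> M)"
      using finite_claimed legal_claim_facts(1) by blast
    then have ex: "\<exists>B. legal_claim b (claimed h \<union> M) B"
      using legal_reply[of "claimed h \<union> M" "{}" b] by auto
    show "legal_claim b (claimed h \<union> M) (\<sigma> h M)"
    proof (cases "\<exists>B. good_reply v N m b h M B")
      case True
      then show ?thesis
        using good by (simp add: good_reply_def)
    next
      case False
      then have "\<sigma> h M = (SOME B. legal_claim b (claimed h \<union> M) B)"
        unfolding \<sigma>_def by (rule if_not_P)
      then show ?thesis
        using someI_ex[OF ex] by simp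
    qed
  qed
  have win: "breaker_wins_within v N p" if p: "play_against m b \<sigma> p" for p
  proof (rule ccontr)
    assume not_won: "\<not> breaker_wins_within v N p"
    have not_sealed: "\<not> sealed v (breaker_edges (rounds p n))" if "n \<le> N" for n
      using not_won that sealed_encloses unfolding breaker_wins_within_def by blast
    have "wins_in (N - n) v m b (maker_edges (rounds p n)) (breaker_edges (rounds p n))"
      if "n \<le> N" for n
      using that
    proof (induction n)
      case 0
      then show ?case
        using assms by (simp add: rounds_def maker_edges_def breaker_edges_def)
    next
      case (Suc n)
      let ?h = "rounds p n"
      have "legal_history m b (rounds p (Suc n))"
        using p by (simp add: play_against_def)
      then have "legal_history m b (?h @ [p n])"
        by (simp add: rounds_def)
      then have M: "legal_claim m (maker_edges ?h \<union> breaker_edges ?h) (fst (p n))"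
        using legal_history_snoc by (simp add: claimed_def)
      have "wins_in (Suc (N - Suc n)) v m b (maker_edges ?h) (breaker_edges ?h)"
        using Suc by (simp add: Suc_diff_Suc)
      then obtain B where "legal_claim b (maker_edges ?h \<union> fst (p n) \<union> breaker_edges ?h) B"
        "wins_in (N - Suc n) v m b (maker_edges ?h \<union> fst (p n)) (breaker_edges ?h \<union> B)"
        using M not_sealed[of n] Suc.prems by auto
      moreover have "maker_edges ?h \<union> fst (p n) \<union> breaker_edges ?h = claimed ?h \<union> fst (p n)"
        by (auto simp: claimed_def)
      moreover have len: "length ?h = n"
        by (simp add: rounds_def)
      ultimately have "good_reply v N m b ?h (fst (p n)) (\<sigma> ?h (fst (p n)))"
        by (intro good) (auto simp: good_reply_def)
      then have "wins_in (N - Suc n) v m b (maker_edges ?h \<union> fst (p n))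
          (breaker_edges ?h \<union> \<sigma> ?h (fst (p n)))"
        by (simp add: good_reply_def len)
      moreover have "snd (p n) = \<sigma> ?h (fst (p n))"
        using p by (simp add: play_against_def)
      ultimately show ?case
        by (simp add: edges_rounds_Suc)
    qed
    from this[of N] not_sealed[of N] show False
      by simp
  qed
  then show ?thesis
    using legal unfolding winning_strategy_def breaker_wins_def by blast
qed

theorem theorem1p2:
  fixes m b :: nat and s :: real and v0 :: vertex
  assumes "m \<ge> 29"
    and "0 \<le> s" and "s \<le> (real m - 22) / 14"
    and "real b \<ge> 2 * real m - s"
  shows "\<exists>\<sigma>. winning_strategy v0 m b \<sigma> \<and>
           (\<forall>p. play_against m b \<sigma> p \<longrightarrow> breaker_wins_within v0 3 p)"
proof -
  define k where "k = 2 * m - b"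
  have "real k \<le> s"
    using assms(2,4) unfolding k_def by (cases "b \<le> 2 * m") (simp_all add: of_nat_diff)
  then have "real (14 * k + 22) \<le> real m"
    using assms(3) by simp
  then have "14 * k + 22 \<le> m"
    by (simp only: of_nat_le_iff)
  moreover have "2 * m \<le> b + k"
    by (simp add: k_def)
  ultimately have "wins_in 3 v0 m b {} {}"
    by (intro wins_from_start)
  then show ?thesis
    by (rule strategy_if_wins_in)
qed

end
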